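(* Let $k\ge 2$ be an integer and let $G$ be a finite, simple, connected, $k$-colourable graph such that $S_k(G)$ is connected. Let $v$ be a vertex of $G$ with neighbourhood $N(v)$, and let $N^*\subseteq N(v)$ with $N^*\neq\varnothing$. Let $G^*$ be the graph obtained from $G$ by adding a new vertex $v^*$ and joining $v^*$ to exactly the vertices of $N^*$. Then $S_k(G^* )$ is connected.
   Context: A proper $k$-colouring of a graph $G$ is a map $V(G)\to\{1,\dots,k\}$ giving adjacent vertices different colours. It is called a strong $k$-colouring if all $k$ colours actually appear. The strong $k$-colour graph $S_k(G)$ is the graph whose vertex set is the set of strong $k$-colourings of $G$, two colourings being adjacent if and only if they differ in colour on exactly one vertex of $G$. *)

theory Defs
  imports "HOL-Library.FuncSet" "Graph_Theory.Graph_Theory"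
begin

text \<open>
  A finite simple graph is a pair digraph satisfying \<open>pair_graph\<close>: a finite vertex set with a
  symmetric, loop-free set of arcs, each edge being represented by its two orientations.
\<close>

definition neighbourhood :: "'a pair_pre_digraph \<Rightarrow> 'a \<Rightarrow> 'a set" where
  "neighbourhood G v = {u. v \<rightarrow>\<^bsub>with_proj G\<^esub> u}"

definition add_joined_vertex ::
    "'a pair_pre_digraph \<Rightarrow> 'a \<Rightarrow> 'a set \<Rightarrow> 'a pair_pre_digraph" where
  "add_joined_vertex G x N =
    \<lparr> pverts = insert x (pverts G), parcs = parcs G \<union> {x} \<times> N \<union> N \<times> {x} \<rparr>"

text \<open>
  Colourings are extensional (\<open>undefined\<close> off the vertex set), so that they correspond exactly
  to maps from the vertex set to the colours.
\<close>

definition proper_colouring :: "nat \<Rightarrow> 'a pair_pre_digraph \<Rightarrow> ('a \<Rightarrow> nat) \<Rightarrow> bool" where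
  "proper_colouring k G c \<longleftrightarrow>
    c \<in> pverts G \<rightarrow>\<^sub>E {1..k} \<and> (\<forall>u v. u \<rightarrow>\<^bsub>with_proj G\<^esub> v \<longrightarrow> c u \<noteq> c v)"

definition colourable :: "nat \<Rightarrow> 'a pair_pre_digraph \<Rightarrow> bool" where
  "colourable k G \<longleftrightarrow> (\<exists>c. proper_colouring k G c)"

definition strong_colouring :: "nat \<Rightarrow> 'a pair_pre_digraph \<Rightarrow> ('a \<Rightarrow> nat) \<Rightarrow> bool" where
  "strong_colouring k G c \<longleftrightarrow> proper_colouring k G c \<and> c ` pverts G = {1..k}"

definition strong_colour_graph ::
    "nat \<Rightarrow> 'a pair_pre_digraph \<Rightarrow> ('a \<Rightarrow> nat) pair_pre_digraph" where
  "strong_colour_graph k G =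
    \<lparr> pverts = {c. strong_colouring k G c},
      parcs = {(c, d). strong_colouring k G c \<and> strong_colouring k G d \<and>
                       (\<exists>!x. x \<in> pverts G \<and> c x \<noteq> d x)} \<rparr>"

text \<open>
  Connectedness is \<^const>\<open>Digraph_Component.connected\<close>, which requires a nonempty vertex set.
  For \<^const>\<open>strong_colour_graph\<close> this matters: on a graph with fewer than \<open>k\<close> vertices
  it is empty, hence not connected.
\<close>

end

theory Submission
  imports Defs "HOL-Combinatorics.Transposition"
begin

text \<open>
  Write \<open>v'\<close> for the new vertex. A strong colouring of \<open>G\<close> extends to the enlarged graph by giving
  \<open>v'\<close> the colour of \<open>v\<close>, and a recolouring step in \<open>G\<close> lifts to at most two steps there, so all
  these extensions are mutually reachable. If the restriction of a strong colouring of the enlarged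
  graph to \<open>G\<close> is strong, then recolouring \<open>v'\<close> gives such an extension.

  Otherwise the restriction misses exactly the colour \<open>a\<close> of \<open>v'\<close>. Recolour vertices of \<open>G\<close> without
  using \<open>a\<close> or losing a colour, and let \<open>Z\<close> be the set of vertices that can be made to share their
  colour with another vertex. If \<open>v \<in> Z\<close>, then \<open>v\<close> may finally take the colour \<open>a\<close>, which is
  allowed because \<open>v\<close> and \<open>v'\<close> are not adjacent, and the colouring becomes strong on \<open>G\<close>. If
  \<open>v \<notin> Z\<close>, then every vertex of \<open>Z\<close> is adjacent to every vertex outside \<open>Z\<close>; hence, starting from a
  strong colouring obtained by giving \<open>a\<close> to some vertex of \<open>Z\<close>, no vertex outside \<open>Z\<close> can ever be
  recoloured. In particular the colour of \<open>v\<close> is constant on a component of the strong colour graph,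
  contradicting its connectedness, as one may exchange two colours.
\<close>

section \<open>Walks in the strong colour graph\<close>

lemma connected_strong_colour_graph_iff:
  "Digraph_Component.connected (with_proj (strong_colour_graph k G)) \<longleftrightarrow>
     (\<exists>c. strong_colouring k G c) \<and>
     (\<forall>c d. strong_colouring k G c \<longrightarrow> strong_colouring k G d \<longrightarrow>
        (c, d) \<in> (parcs (strong_colour_graph k G))\<^sup>*)"
proof -
  let ?S = "strong_colour_graph k G"
  have wf: "pair_wf_digraph ?S"
    by unfold_locales (auto simp: strong_colour_graph_def)
  have sym: "sym (parcs ?S)"
    unfolding sym_def strong_colour_graph_def by (auto simp: eq_commute)
  have mk: "parcs (mk_symmetric (with_proj ?S)) = parcs ?S"
    using sym by (auto simp: parcs_mk_symmetric sym_def)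
  have reach: "c \<rightarrow>\<^sup>*\<^bsub>with_proj (mk_symmetric (with_proj ?S))\<^esub> d \<longleftrightarrow> (c, d) \<in> (parcs ?S)\<^sup>*"
    if "strong_colouring k G c" for c d
  proof -
    have c: "c \<in> pverts ?S"
      using that by (simp add: strong_colour_graph_def)
    \<comment> \<open>Arcs end in vertices, so a walk that starts at a vertex never leaves the
      vertex set and plain reflexive-transitive closure suffices.\<close>
    have "(c, d) \<in> rtrancl_on (pverts ?S) (parcs ?S)" if "(c, d) \<in> (parcs ?S)\<^sup>*"
      using that
    proof induction
      case base
      then show ?case using c by simp
    next
      case (step d e)
      then show ?case
        using pair_wf_digraph.wellformed'[OF wf] by (auto intro: rtrancl_on_into_rtrancl_on)
    qed
    then show ?thesis
      by (auto simp: reachable_def mk intro: rtrancl_on_rtranclI)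
  qed
  have "pverts ?S = {c. strong_colouring k G c}"
    by (simp add: strong_colour_graph_def)
  then show ?thesis
    by (auto simp: connected_def strongly_connected_def reach)
qed

lemma strong_colour_graph_rtrancl_sym:
  "(c, d) \<in> (parcs (strong_colour_graph k G))\<^sup>* \<Longrightarrow> (d, c) \<in> (parcs (strong_colour_graph k G))\<^sup>*"
proof -
  have "sym (parcs (strong_colour_graph k G))"
    unfolding sym_def strong_colour_graph_def by (auto simp: eq_commute)
  then show "(c, d) \<in> (parcs (strong_colour_graph k G))\<^sup>* \<Longrightarrow> ?thesis"
    by (meson sym_rtrancl symE)
qed

lemma strong_colour_graph_updI:
  assumes "strong_colouring k G c" "strong_colouring k G (c(x := b))" "x \<in> pverts G"
  shows "(c, c(x := b)) \<in> (parcs (strong_colour_graph k G))\<^sup>*"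
proof (cases "b = c x")
  case False
  then have "(c, c(x := b)) \<in> parcs (strong_colour_graph k G)"
    using assms by (auto simp: strong_colour_graph_def)
  then show ?thesis by blast
qed auto

lemma strong_colour_graphE:
  assumes "(c, d) \<in> parcs (strong_colour_graph k G)"
  obtains x where "strong_colouring k G c" "strong_colouring k G d" "x \<in> pverts G"
    "d = c(x := d x)" "d x \<noteq> c x"
proof -
  have c: "strong_colouring k G c" and d: "strong_colouring k G d"
    and ex1: "\<exists>!x. x \<in> pverts G \<and> c x \<noteq> d x"
    using assms by (simp_all add: strong_colour_graph_def)
  from ex1 obtain x where x: "x \<in> pverts G" and ne: "c x \<noteq> d x"
    and uniq: "\<And>y. y \<in> pverts G \<Longrightarrow> c y \<noteq> d y \<Longrightarrow> y = x"
    by (elim ex1E) blast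
  \<comment> \<open>Both colourings are \<open>undefined\<close> off the vertex set, so differing at
    a single vertex becomes an equation between functions.\<close>
  have "d y = c y" if "y \<notin> pverts G" for y
    using c d that by (auto simp: strong_colouring_def proper_colouring_def PiE_def extensional_def)
  then have "d = c(x := d x)"
    using uniq by fastforce
  then show thesis
    using that c d x ne by metis
qed

lemma proper_colouring_upd:
  assumes "pair_graph G" "proper_colouring k G c" "x \<in> pverts G" "b \<in> {1..k}"
    and "\<And>u. (x, u) \<in> parcs G \<Longrightarrow> c u \<noteq> b"
  shows "proper_colouring k G (c(x := b))"
proof -
  interpret pair_graph G by fact
  have "(u, w) \<in> parcs G \<Longrightarrow> (w, u) \<in> parcs G" "(u, w) \<in> parcs G \<Longrightarrow> u \<noteq> w" for u w
    using graph_symmetric pair_no_loops[of "(u, w)"] by auto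
  then show ?thesis
    using assms by (fastforce simp: proper_colouring_def PiE_def extensional_def)
qed

section \<open>Recolouring with a fixed set of colours\<close>

lemma image_upd_shared:
  assumes "x \<in> V" "u \<in> V" "u \<noteq> x" "c u = c x"
  shows "(c(x := b)) ` V = insert b (c ` V)"
proof -
  have "c x \<in> c ` (V - {x})"
    using assms by (metis image_eqI insertE insert_Diff)
  then have "c ` (V - {x}) = c ` V"
    by blast
  then show ?thesis
    using assms(1) by auto
qed

text \<open>The colour set is held fixed instead of being all of \<open>{1..k}\<close>: when it is
  \<open>{1..k} - {a}\<close>, these are the moves in G while the new vertex holds \<open>a\<close>.
  Trivial moves are allowed.\<close>

definition recolouring :: "nat \<Rightarrow> 'a pair_pre_digraph \<Rightarrow> (('a \<Rightarrow> nat) \<times> ('a \<Rightarrow> nat)) set" where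
  "recolouring k G =
    {(c, d). proper_colouring k G c \<and> proper_colouring k G d \<and> c ` pverts G = d ` pverts G \<and>
       (\<exists>x\<in>pverts G. \<exists>b. d = c(x := b))}"

lemma recolouring_rtrancl_invariant:
  assumes "(c, d) \<in> (recolouring k G)\<^sup>*" "proper_colouring k G c"
  shows "proper_colouring k G d \<and> d ` pverts G = c ` pverts G"
  using assms by induction (auto simp: recolouring_def)

text \<open>This is the set Z of the proof idea.\<close>

definition shareable :: "nat \<Rightarrow> 'a pair_pre_digraph \<Rightarrow> ('a \<Rightarrow> nat) \<Rightarrow> 'a set" where
  "shareable k G c =
    {z \<in> pverts G. \<exists>d u. (c, d) \<in> (recolouring k G)\<^sup>* \<and> u \<in> pverts G \<and> u \<noteq> z \<and> d u = d z}"

lemma shareableI: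
  assumes "(c, d) \<in> (recolouring k G)\<^sup>*" "z \<in> pverts G" "u \<in> pverts G" "u \<noteq> z" "d u = d z"
  shows "z \<in> shareable k G c"
  using assms by (auto simp: shareable_def)

text \<open>Move to a colouring \<open>d\<close> in which \<open>z\<close> shares its colour. There
  \<open>y\<close> is alone with its colour, so if \<open>z\<close> were not adjacent to
  \<open>y\<close> it could take the colour of \<open>y\<close>, its own surviving at
  \<open>u\<close>; then \<open>y\<close> would share as well.\<close>

lemma shareable_joined:
  assumes G: "pair_graph G" and c: "proper_colouring k G c"
    and z: "z \<in> shareable k G c" and y: "y \<in> pverts G" "y \<notin> shareable k G c"
  shows "(z, y) \<in> parcs G"
proof (rule ccontr)
  assume nadj: "(z, y) \<notin> parcs G"
  obtain d u where d: "(c, d) \<in> (recolouring k G)\<^sup>*" and u: "u \<in> pverts G" "u \<noteq> z" "d u = d z"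
    and zV: "z \<in> pverts G"
    using z by (auto simp: shareable_def)
  have pd: "proper_colouring k G d"
    using recolouring_rtrancl_invariant[OF d c] by blast
  have "d y \<noteq> d w" if "w \<in> pverts G" "w \<noteq> y" for w
    using shareableI[OF d y(1) that] y(2) by metis
  moreover have "w \<in> pverts G" if "(z, w) \<in> parcs G" for w
    using that pair_wf_digraph.in_arcsD2 G
    by (metis pair_digraph_def pair_fin_digraph_def pair_graph_def)
  ultimately have "proper_colouring k G (d(z := d y))"
    using nadj pd y(1) zV
    by (intro proper_colouring_upd[OF G pd]) (auto simp: proper_colouring_def PiE_def, metis)
  moreover have "(d(z := d y)) ` pverts G = d ` pverts G"
    using image_upd_shared[OF zV u(1,2,3)] y(1) by auto
  ultimately have "(d, d(z := d y)) \<in> recolouring k G"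
    using pd zV by (auto simp: recolouring_def)
  then have "(c, d(z := d y)) \<in> (recolouring k G)\<^sup>*"
    using d by simp
  moreover have "z \<noteq> y"
    using z y by auto
  ultimately show False
    using shareableI[of c "d(z := d y)" k G y z] y zV by auto
qed

text \<open>As long as the colouring agrees with \<open>c\<close> outside Z, each vertex there is
  the only one of its colour: it is adjacent to all of Z, and outside Z even \<open>c\<close>
  repeats no colour. Recolouring it would lose a colour.\<close>

lemma frozen_outside_shareable:
  assumes G: "pair_graph G" and c: "proper_colouring k G c"
    and cd: "(d, e) \<in> (parcs (strong_colour_graph k G))\<^sup>*"
    and dc: "\<And>y. y \<in> pverts G - shareable k G c \<Longrightarrow> d y = c y"
  shows "\<forall>y \<in> pverts G - shareable k G c. e y = c y"
  using cd
proof induction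
  case base
  then show ?case using dc by blast
next
  case (step e f)
  let ?Y = "pverts G - shareable k G c"
  from step.hyps(2) obtain x where e: "strong_colouring k G e" and f: "strong_colouring k G f"
    and x: "x \<in> pverts G" "f = e(x := f x)" "f x \<noteq> e x"
    by (rule strong_colour_graphE)
  have "x \<notin> ?Y"
  proof
    assume xY: "x \<in> ?Y"
    have "e x \<noteq> e w" if w: "w \<in> pverts G" "w \<noteq> x" for w
    proof (cases "w \<in> shareable k G c")
      case True
      then have "(w, x) \<in> parcs G"
        using shareable_joined[OF G c] xY by blast
      then show ?thesis
        using e unfolding strong_colouring_def proper_colouring_def with_proj_simps by metis
    next
      case False
      then show ?thesis
        using shareableI[of c c k G x w] xY w step.IH by auto
    qed
    then have "e x \<notin> f ` pverts G"
      using x by (smt (verit) fun_upd_apply imageE)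
    moreover have "e x \<in> f ` pverts G"
      using e f x(1) by (auto simp: strong_colouring_def)
    ultimately show False by blast
  qed
  then show ?case
    using step.IH x(2) by (metis fun_upd_apply)
qed

lemma strong_colouring_transpose:
  assumes "pair_graph G" "strong_colouring k G c" "a \<in> {1..k}" "b \<in> {1..k}"
  shows "strong_colouring k G (\<lambda>x\<in>pverts G. transpose a b (c x))" (is "strong_colouring k G ?d")
proof -
  interpret pair_graph G by fact
  have tr: "transpose a b ` {1..k} = {1..k}"
    using assms(3,4) by (auto simp: transpose_image_eq)
  have "?d ` pverts G = transpose a b ` c ` pverts G"
    by auto
  then have im: "?d ` pverts G = {1..k}"
    using assms(2) tr by (simp add: strong_colouring_def)
  moreover have "?d u \<noteq> ?d w" if "(u, w) \<in> parcs G" for u w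
    using assms(2) that wellformed'[OF that]
    by (auto simp: strong_colouring_def proper_colouring_def dest: transpose_eq_imp_eq)
  ultimately show ?thesis
    by (auto simp: strong_colouring_def proper_colouring_def)
qed

lemma shareable_if_connected:
  assumes G: "pair_graph G" and k: "k \<ge> 2"
    and conn: "Digraph_Component.connected (with_proj (strong_colour_graph k G))"
    and c: "proper_colouring k G c" "c ` pverts G = {1..k} - {a}" and a: "a \<in> {1..k}"
    and v: "v \<in> pverts G"
  shows "v \<in> shareable k G c"
proof (rule ccontr)
  assume nv: "v \<notin> shareable k G c"
  interpret pair_graph G by fact
  obtain s where s: "strong_colouring k G s"
    and reach: "\<And>d e. strong_colouring k G d \<Longrightarrow> strong_colouring k G e \<Longrightarrow>
      (d, e) \<in> (parcs (strong_colour_graph k G))\<^sup>*"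
    using conn unfolding connected_strong_colour_graph_iff by blast
  \<comment> \<open>Pigeonhole: \<open>c\<close> uses fewer than k colours, while the strong
    colouring \<open>s\<close> forces at least k vertices. Hence Z is nonempty.\<close>
  have "card (c ` pverts G) < k"
    using c(2) a k by simp
  also have "k = card (s ` pverts G)"
    using s by (simp add: strong_colouring_def)
  also have "\<dots> \<le> card (pverts G)"
    by (simp add: card_image_le pair_finite_verts)
  finally have "\<not> inj_on c (pverts G)"
    using card_image by force
  then obtain u w where uw: "u \<in> pverts G" "w \<in> pverts G" "w \<noteq> u" "c w = c u"
    by (auto simp: inj_on_def)
  have u: "u \<in> shareable k G c"
    using shareableI[of c c k G u w] uw by auto
  have "c x \<noteq> a" if "x \<in> pverts G" for x
    using that c(2) by blast
  then have "proper_colouring k G (c(u := a))"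
    using wellformed' by (intro proper_colouring_upd[OF G c(1) uw(1) a]) blast
  then have d: "strong_colouring k G (c(u := a))"
    using image_upd_shared[OF uw] c(2) a by (auto simp: strong_colouring_def)
  have "c v \<in> {1..k}"
    using c(2) v by blast
  \<comment> \<open>A second colour exists because k is at least 2; exchanging it with
    \<open>c v\<close> gives a strong colouring that differs at \<open>v\<close>.\<close>
  moreover obtain b where b: "b \<in> {1..k}" "b \<noteq> c v"
  proof (cases "c v = 1")
    case True
    then show ?thesis using that[of 2] k by auto
  next
    case False
    then show ?thesis using that[of 1] k by auto
  qed
  ultimately have e: "strong_colouring k G (\<lambda>x\<in>pverts G. transpose (c v) b ((c(u := a)) x))"
    (is "strong_colouring k G ?e")
    using strong_colouring_transpose[OF G d] by blast
  \<comment> \<open>Since \<open>u\<close> lies in Z, \<open>c(u := a)\<close> agrees with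
    \<open>c\<close> outside Z, so the colour of \<open>v\<close> is frozen along the walk.\<close>
  have "?e v = c v"
    using frozen_outside_shareable[OF G c(1) reach[OF d e]] u v nv by fastforce
  moreover have "?e v = b"
    using u v nv by auto
  ultimately show False
    using b by simp
qed

section \<open>Colourings of the enlarged graph\<close>

lemma proper_colouring_add_iff:
  assumes "pair_graph G" "v' \<notin> pverts G" "N \<subseteq> pverts G" "c v' = undefined"
  shows "proper_colouring k (add_joined_vertex G v' N) (c(v' := a)) \<longleftrightarrow>
    proper_colouring k G c \<and> a \<in> {1..k} \<and> a \<notin> c ` N"
proof -
  interpret pair_graph G by fact
  \<comment> \<open>The value \<open>undefined\<close> at \<open>v'\<close> is what makes
    \<open>c\<close> extensional on the smaller vertex set.\<close>
  have "c(v' := a) \<in> insert v' (pverts G) \<rightarrow>\<^sub>E {1..k} \<longleftrightarrow> c \<in> pverts G \<rightarrow>\<^sub>E {1..k} \<and> a \<in> {1..k}"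
    using assms(2,4) by (auto simp: PiE_def extensional_def Pi_def)
  moreover have "(\<forall>u w. (u, w) \<in> parcs G \<union> {v'} \<times> N \<union> N \<times> {v'} \<longrightarrow> (c(v' := a)) u \<noteq> (c(v' := a)) w)
    \<longleftrightarrow> (\<forall>u w. (u, w) \<in> parcs G \<longrightarrow> c u \<noteq> c w) \<and> a \<notin> c ` N"
    (is "?L \<longleftrightarrow> ?R")
  proof
    assume ?R
    then show ?L
      using assms(2,3) wellformed' by auto
  next
    assume L: ?L
    have "c u \<noteq> c w" if "(u, w) \<in> parcs G" for u w
      using L[rule_format, of u w] that wellformed'[OF that] assms(2) by (auto split: if_splits)
    moreover have "a \<noteq> c u" if "u \<in> N" for u
      using L[rule_format, of v' u] that assms(2,3) by auto
    ultimately show ?R by blast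
  qed
  ultimately show ?thesis
    by (auto simp: proper_colouring_def add_joined_vertex_def)
qed

lemma proper_colouring_undefined:
  "proper_colouring k G c \<Longrightarrow> x \<notin> pverts G \<Longrightarrow> c x = undefined"
  by (auto simp: proper_colouring_def PiE_def extensional_def)

lemma strong_colouring_add_iff:
  assumes "pair_graph G" "v' \<notin> pverts G" "N \<subseteq> pverts G" "proper_colouring k G c"
  shows "strong_colouring k (add_joined_vertex G v' N) (c(v' := a)) \<longleftrightarrow>
    a \<in> {1..k} \<and> a \<notin> c ` N \<and> insert a (c ` pverts G) = {1..k}"
proof -
  have "(c(v' := a)) ` pverts (add_joined_vertex G v' N) = insert a (c ` pverts G)"
    using assms(2) by (auto simp: add_joined_vertex_def)
  then show ?thesis
    using proper_colouring_add_iff[where c = c, OF assms(1-3) proper_colouring_undefined[OF assms(4,2)]] assms(4)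
    by (simp add: strong_colouring_def)
qed

lemma strong_colouring_addE:
  assumes "pair_graph G" "v' \<notin> pverts G" "N \<subseteq> pverts G"
    and e: "strong_colouring k (add_joined_vertex G v' N) e"
  obtains c where "proper_colouring k G c" "e = c(v' := e v')"
proof
  show "e = (e(v' := undefined))(v' := e v')"
    by simp
  have "proper_colouring k (add_joined_vertex G v' N) ((e(v' := undefined))(v' := e v'))"
    using e by (simp add: strong_colouring_def)
  then show "proper_colouring k G (e(v' := undefined))"
    using proper_colouring_add_iff[OF assms(1-3), of "e(v' := undefined)" k "e v'"] by simp
qed

section \<open>Walks in the strong colour graph of the enlarged graph\<close>

context
  fixes G :: "'a pair_pre_digraph" and k :: nat and v v' :: 'a and N :: "'a set"
  assumes G: "pair_graph G" and v: "v \<in> pverts G" and N: "N \<subseteq> neighbourhood G v"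
    and v': "v' \<notin> pverts G"
begin

interpretation pair_graph G by (fact G)

abbreviation (input) "G' \<equiv> add_joined_vertex G v' N"

abbreviation (input) "R' \<equiv> parcs (strong_colour_graph k G')"

lemma N_subset: "N \<subseteq> pverts G"
  using N wellformed' by (auto simp: neighbourhood_def)

lemma verts_add: "x \<in> pverts G \<Longrightarrow> x \<in> pverts G'" "v' \<in> pverts G'"
  by (auto simp: add_joined_vertex_def)

lemmas strong_add_iff = strong_colouring_add_iff[OF G v' N_subset]

text \<open>Every vertex of \<open>N\<close> is adjacent to \<open>v\<close>; this is why the new
  vertex may copy the colour of \<open>v\<close>.\<close>

lemma colour_notin_N:
  assumes "proper_colouring k G c"
  shows "c v \<notin> c ` N"
  using assms N by (force simp: neighbourhood_def proper_colouring_def)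

lemma strong_extension:
  assumes "strong_colouring k G c" "a \<in> {1..k}" "a \<notin> c ` N"
  shows "strong_colouring k G' (c(v' := a))"
  using assms strong_add_iff by (auto simp: strong_colouring_def)

lemma strong_extension_v:
  assumes "strong_colouring k G c"
  shows "strong_colouring k G' (c(v' := c v))"
  using assms v by (intro strong_extension colour_notin_N) (auto simp: strong_colouring_def)

lemma reach_extension_v:
  assumes c: "strong_colouring k G c" and ca: "strong_colouring k G' (c(v' := a))"
  shows "(c(v' := a), c(v' := c v)) \<in> R'\<^sup>*"
  using strong_colour_graph_updI[OF ca, of v' "c v"] strong_extension_v[OF c] verts_add by simp

text \<open>First \<open>x\<close> is recoloured while \<open>v'\<close> keeps \<open>c v\<close>,
  then \<open>v'\<close> follows \<open>v\<close>. The intermediate colouring is proper: if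
  \<open>x = v\<close>, the colours on \<open>N\<close> do not change, and otherwise
  \<open>v\<close> keeps its colour.\<close>

lemma reach_step:
  assumes "(c, d) \<in> parcs (strong_colour_graph k G)"
  shows "(c(v' := c v), d(v' := d v)) \<in> R'\<^sup>*"
proof -
  obtain x where c: "strong_colouring k G c" and d: "strong_colouring k G d"
    and x: "x \<in> pverts G" "d = c(x := d x)" "d x \<noteq> c x"
    using assms by (rule strong_colour_graphE)
  have N_c: "c v \<notin> c ` N"
    using c colour_notin_N by (simp add: strong_colouring_def)
  have "c v \<notin> d ` N"
  proof (cases "x = v")
    case True
    then have "v \<notin> N"
      using N pair_no_loops[of "(v, v)"] by (auto simp: neighbourhood_def)
    then have "d ` N = c ` N"
      using x(2) True by (intro image_cong) (auto simp: fun_upd_def, metis)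
    then show ?thesis using N_c by simp
  next
    case False
    then have "d v = c v"
      using x(2) by (metis fun_upd_apply)
    then show ?thesis
      using d colour_notin_N by (metis strong_colouring_def)
  qed
  moreover have "c v \<in> {1..k}"
    using c v by (auto simp: strong_colouring_def)
  ultimately have mid: "strong_colouring k G' (d(v' := c v))"
    using d strong_extension by blast
  moreover have "d(v' := c v) = (c(v' := c v))(x := d x)"
    using x(1,2) v' by (metis fun_upd_twist)
  ultimately have "(c(v' := c v), d(v' := c v)) \<in> R'\<^sup>*"
    using strong_colour_graph_updI[OF strong_extension_v[OF c], of x "d x"] verts_add x(1) by simp
  then show ?thesis
    using reach_extension_v[OF d mid] by (rule rtrancl_trans)
qed

lemma reach_rtrancl:
  assumes "(c, d) \<in> (parcs (strong_colour_graph k G))\<^sup>*"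
  shows "(c(v' := c v), d(v' := d v)) \<in> R'\<^sup>*"
  using assms
proof induction
  case (step d e)
  show ?case
    using step.IH reach_step[OF step.hyps(2)] by (rule rtrancl_trans)
qed auto

text \<open>The colour \<open>a\<close> stays on \<open>v'\<close> and off G throughout, so no move
  conflicts with \<open>v'\<close> and all k colours remain present.\<close>

lemma reach_recolouring:
  assumes cd: "(c, d) \<in> (recolouring k G)\<^sup>*" and c: "proper_colouring k G c"
    and a: "a \<in> {1..k}" "c ` pverts G = {1..k} - {a}"
  shows "(c(v' := a), d(v' := a)) \<in> R'\<^sup>*"
  using cd
proof induction
  case (step d e)
  have strong: "strong_colouring k G' (f(v' := a))"
    if "(c, f) \<in> (recolouring k G)\<^sup>*" for f
  proof -
    have "proper_colouring k G f" "f ` pverts G = {1..k} - {a}"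
      using recolouring_rtrancl_invariant[OF that c] a by auto
    then show ?thesis
      using strong_add_iff[of k f a] a(1) N_subset by blast
  qed
  obtain x b where x: "x \<in> pverts G" "e = d(x := b)"
    using step.hyps(2) by (auto simp: recolouring_def)
  have "e(v' := a) = (d(v' := a))(x := b)"
    using x v' by (metis fun_upd_twist)
  then have "(d(v' := a), e(v' := a)) \<in> R'\<^sup>*"
    using strong_colour_graph_updI[OF strong[OF step.hyps(1)], of x b]
      strong[OF rtrancl_into_rtrancl[OF step.hyps]] verts_add x(1) by simp
  then show ?case
    using step.IH by (rule rtrancl_trans[rotated])
qed auto

text \<open>This brings an arbitrary strong colouring into the family of extensions in which
  \<open>v'\<close> copies \<open>v\<close>; \<open>reach_rtrancl\<close> connects that
  family.\<close>

lemma reach_strong_restriction: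
  assumes k: "k \<ge> 2"
    and conn: "Digraph_Component.connected (with_proj (strong_colour_graph k G))"
    and e: "strong_colouring k G' e"
  obtains c where "strong_colouring k G c" "(e, c(v' := c v)) \<in> R'\<^sup>*"
proof -
  obtain c where c: "proper_colouring k G c" and ec: "e = c(v' := e v')"
    using e by (rule strong_colouring_addE[OF G v' N_subset])
  define a where "a = e v'"
  have ca: "a \<in> {1..k}" "insert a (c ` pverts G) = {1..k}"
    using e strong_add_iff[OF c, of a] ec by (auto simp: a_def)
  show thesis
  \<comment> \<open>Either G already shows all k colours, or \<open>v'\<close> is the only vertex
    coloured \<open>a\<close>.\<close>
  proof (cases "a \<in> c ` pverts G")
    case True
    then have "strong_colouring k G c"
      using c ca by (auto simp: strong_colouring_def)
    then show thesis
      using that reach_extension_v e ec by metis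
  next
    case False
    then have miss: "c ` pverts G = {1..k} - {a}"
      using ca by auto
    obtain d u where d: "(c, d) \<in> (recolouring k G)\<^sup>*" and u: "u \<in> pverts G" "u \<noteq> v" "d u = d v"
      using shareable_if_connected[OF G k conn c miss ca(1) v] by (auto simp: shareable_def)
    have pd: "proper_colouring k G d" and dim: "d ` pverts G = {1..k} - {a}"
      using recolouring_rtrancl_invariant[OF d c] miss by auto
    have ed: "(e, d(v' := a)) \<in> R'\<^sup>*"
      using reach_recolouring[OF d c ca(1) miss] ec by (simp add: a_def)
    have na: "d x \<noteq> a" if "x \<in> pverts G" for x
      using that dim by blast
    have "proper_colouring k G (d(v := a))"
      using na wellformed' by (intro proper_colouring_upd[OF G pd v ca(1)]) blast
    \<comment> \<open>The old colour of \<open>v\<close> survives at \<open>u\<close>, so G gains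
      \<open>a\<close> and loses nothing.\<close>
    then have strong: "strong_colouring k G (d(v := a))"
      using image_upd_shared[OF v u] dim ca(1) by (auto simp: strong_colouring_def)
    have da: "strong_colouring k G' (d(v' := a))"
      using strong_add_iff[OF pd] dim ca(1) N_subset by blast
    \<comment> \<open>After this move \<open>v\<close> and \<open>v'\<close> both have colour
      \<open>a\<close>, which is the extension of \<open>d(v := a)\<close> copying
      \<open>v\<close>.\<close>
    have "(d(v' := a), (d(v' := a))(v := a)) \<in> R'\<^sup>*"
      using strong_colour_graph_updI[OF da, of v a] strong_extension_v[OF strong] verts_add(1)[OF v] v v'
      by (metis fun_upd_same fun_upd_twist)
    then have "(e, (d(v := a))(v' := (d(v := a)) v)) \<in> R'\<^sup>*"
      using ed v v' by (metis fun_upd_same fun_upd_twist rtrancl_trans)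
    then show thesis
      using that strong by blast
  qed
qed

end

theorem theorem2p3:
  fixes G :: "'a pair_pre_digraph" and k :: nat and v v' :: 'a and N' :: "'a set"
  assumes "k \<ge> 2"
    and "pair_graph G"
    and "Digraph_Component.connected (with_proj G)"
    and "colourable k G"
    and "Digraph_Component.connected (with_proj (strong_colour_graph k G))"
    and "v \<in> pverts G"
    and "N' \<subseteq> neighbourhood G v" and "N' \<noteq> {}"
    and "v' \<notin> pverts G"
  shows "Digraph_Component.connected
           (with_proj (strong_colour_graph k (add_joined_vertex G v' N')))"
proof -
  note ctx = assms(2,6,7,9)
  have reach: "(d, e) \<in> (parcs (strong_colour_graph k (add_joined_vertex G v' N')))\<^sup>*"
    if de: "strong_colouring k (add_joined_vertex G v' N') d"
      "strong_colouring k (add_joined_vertex G v' N') e" for d e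
  proof -
    let ?R = "parcs (strong_colour_graph k (add_joined_vertex G v' N'))"
    \<comment> \<open>The walk goes from \<open>d\<close> to an extension, along a lifted walk of G
      to another extension, and back to \<open>e\<close>.\<close>
    obtain c1 where c1: "strong_colouring k G c1" "(d, c1(v' := c1 v)) \<in> ?R\<^sup>*"
      using reach_strong_restriction[OF ctx assms(1,5) de(1)] .
    obtain c2 where c2: "strong_colouring k G c2" "(e, c2(v' := c2 v)) \<in> ?R\<^sup>*"
      using reach_strong_restriction[OF ctx assms(1,5) de(2)] .
    have "(c1, c2) \<in> (parcs (strong_colour_graph k G))\<^sup>*"
      using assms(5) c1(1) c2(1) by (simp add: connected_strong_colour_graph_iff)
    then have "(c1(v' := c1 v), c2(v' := c2 v)) \<in> ?R\<^sup>*"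
      by (rule reach_rtrancl[OF ctx])
    then show ?thesis
      using c1(2) strong_colour_graph_rtrancl_sym[OF c2(2)] by (meson rtrancl_trans)
  qed
  \<comment> \<open>Connectedness also demands a vertex; an extension of \<open>s\<close> provides
    one.\<close>
  obtain s where "strong_colouring k G s"
    using assms(5) unfolding connected_strong_colour_graph_iff by blast
  then have "strong_colouring k (add_joined_vertex G v' N') (s(v' := s v))"
    by (rule strong_extension_v[OF ctx])
  then show ?thesis
    using reach unfolding connected_strong_colour_graph_iff by blast
qed

end
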